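(* For an integer $n \ge 0$, let $X_n$ be a uniformly random binary string of length $n$, and let $N_n$ be the total number of distinct subsequences of $X_n$ (of all lengths, including the empty subsequence). Then \[ \mathbb{E}[N_n] = 2\left(\tfrac{3}{2}\right)^n - 1 . \]
   Context: A subsequence of a string $s = s_0 s_1\cdots s_{n-1}$ is a string $s_{i_1}s_{i_2}\cdots s_{i_k}$ with $k\ge 0$ and $0\le i_1<\dots<i_k\le n-1$ (not necessarily contiguous). Subsequences are counted as distinct strings, i.e. different index choices yielding the same string are counted once. *)

theory Defs
  imports "HOL-Probability.Probability" "HOL-Library.Sublist"
begin

(* Sublist.subseq is the not necessarily contiguous subsequence relation; it is
   characterized by increasing index choices in Sublist.subseq_conv_nths.  Subsequences
   are counted here as strings, not as index choices. *)
definition num_subseqs :: "'a list \<Rightarrow> nat" where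
  "num_subseqs s = card {t. subseq t s}"

definition random_binary_string :: "nat \<Rightarrow> bool list pmf" where
  "random_binary_string n = pmf_of_set {s. length s = n}"

(* pmf_of_set is uniform only on a finite non-empty set, and card of an infinite set is 0:
   the next three lemmas exclude both degenerate cases. *)
lemma finite_subseq_set: "finite {t. subseq t s}"
  unfolding set_subseqs_eq[symmetric] by (rule List.finite_set)

lemma finite_binary_strings: "finite {s :: bool list. length s = n}"
  using finite_lists_length_eq[of "UNIV :: bool set" n] by simp

lemma binary_strings_nonempty: "{s :: bool list. length s = n} \<noteq> {}"
proof -
  have "replicate n True \<in> {s. length s = n}" by simp
  then show ?thesis by (auto simp only: empty_iff)
qed

end

(* Prepending each letter in turn gives N(True s) + N(False s) = 3 N(s) + 1: the subsequences of
   b s starting with b correspond to all subsequences of s, while those starting with the other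
   letter are the subsequences of s starting with it.  Hence the sum of N over the strings of
   length n is 2 * 3^n - 2^n. *)
theory Submission
  imports Defs
begin

text \<open>Counting the tails \<open>t\<close> instead of the strings \<open>x # t\<close> lets the
  recursion below follow by simplification of \<open>subseq\<close> on two conses.\<close>

definition num_subseqs_with_head :: "'a \<Rightarrow> 'a list \<Rightarrow> nat" where
  "num_subseqs_with_head x s = card {t. subseq (x # t) s}"

lemma num_subseqs_with_head_Cons:
  "num_subseqs_with_head x (y # s) =
     (if x = y then num_subseqs s else num_subseqs_with_head x s)"
  by (simp add: num_subseqs_with_head_def num_subseqs_def)

text \<open>A subsequence is empty or starts with exactly one of the two letters, and prepending a
  fixed letter is injective.\<close>

lemma num_subseqs_split_head:
  fixes s :: "bool list"
  shows "num_subseqs s = 1 + num_subseqs_with_head True s + num_subseqs_with_head False s"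
proof -
  let ?H = "\<lambda>x. {t. subseq (x # t) s}"
  have fin: "finite (?H x)" for x
    by (rule finite_subset[OF _ finite_subseq_set[of s]]) (auto dest: subseq_Cons')
  have "{t. subseq t s} = insert [] ((#) True ` ?H True \<union> (#) False ` ?H False)" (is "?L = ?R")
  proof (rule set_eqI)
    fix t
    show "t \<in> ?L \<longleftrightarrow> t \<in> ?R"
    proof (cases t)
      case (Cons b u)
      then show ?thesis by (cases b) auto
    qed auto
  qed
  moreover have "card ((#) True ` ?H True \<union> (#) False ` ?H False) = card (?H True) + card (?H False)"
    by (subst card_Un_disjoint) (auto simp: fin card_image)
  ultimately show ?thesis
    using fin by (simp add: num_subseqs_def num_subseqs_with_head_def card_insert_if image_iff)
qed

lemma num_subseqs_Cons_sum:
  "num_subseqs (True # s) + num_subseqs (False # s) = 3 * num_subseqs s + 1"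
  \<comment> \<open>With N = \<open>num_subseqs s\<close>, the two splits add up to 2 + 2 N plus
    both head counts of \<open>s\<close>, and these total N - 1.\<close>
  using num_subseqs_split_head[of s]
  by (simp add: num_subseqs_split_head[of "_ # _"] num_subseqs_with_head_Cons)

lemma sum_binary_strings_Suc:
  fixes f :: "bool list \<Rightarrow> 'b::comm_monoid_add"
  shows "(\<Sum>s | length s = Suc n. f s) = (\<Sum>s | length s = n. f (True # s) + f (False # s))"
proof -
  let ?S = "{s :: bool list. length s = n}"
  have "{s :: bool list. length s = Suc n} = (#) True ` ?S \<union> (#) False ` ?S"
    by (auto simp: length_Suc_conv image_iff)
  moreover have "sum f ((#) True ` ?S \<union> (#) False ` ?S) = sum f ((#) True ` ?S) + sum f ((#) False ` ?S)"
    by (rule sum.union_disjoint) (auto simp: finite_binary_strings)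
  ultimately show ?thesis
    by (simp add: sum.reindex sum.distrib)
qed

lemma card_binary_strings: "card {s :: bool list. length s = n} = 2 ^ n"
  using card_lists_length_eq[of "UNIV :: bool set" n] by simp

text \<open>The sums satisfy a(0) = 1 and a(n+1) = 3 a(n) + 2^n, where 2^n collects the summand 1
  from each string of length n.\<close>

lemma sum_num_subseqs:
  "(\<Sum>s | length s = n. real (num_subseqs (s :: bool list))) = 2 * 3 ^ n - 2 ^ n"
proof (induction n)
  case 0
  have "{t :: bool list. subseq t []} = {[]}" by auto
  then show ?case by (simp add: num_subseqs_def)
next
  case (Suc n)
  have "(\<Sum>s | length s = Suc n. real (num_subseqs (s :: bool list)))
      = (\<Sum>s | length s = n. 3 * real (num_subseqs (s :: bool list)) + 1)"
    unfolding sum_binary_strings_Suc of_nat_add[symmetric] num_subseqs_Cons_sum by (simp add: add.commute)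
  also have "\<dots> = 3 * (2 * 3 ^ n - 2 ^ n) + 2 ^ n"
    by (simp add: sum.distrib sum_distrib_left[symmetric] Suc card_binary_strings)
  finally show ?case by simp
qed

theorem theorem3:
  fixes n :: nat
  shows "measure_pmf.expectation (random_binary_string n) (\<lambda>s. real (num_subseqs s))
           = 2 * (3 / 2) ^ n - 1"
  \<comment> \<open>The expectation is the sum divided by the 2^n strings.\<close>
  unfolding random_binary_string_def
    integral_pmf_of_set[OF binary_strings_nonempty finite_binary_strings]
    sum_num_subseqs card_binary_strings
  by (simp add: diff_divide_distrib power_divide)

end
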